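(* Let $\gamma,\alpha\in(0,1)$. Consider testing $s$ null hypotheses, with $|I|$ of them true. Let $\hat q_{(1)}\le\cdots\le\hat q_{(|I|)}$ denote the ordered p-values corresponding to the true null hypotheses. Set $M=\min(\lfloor\gamma s\rfloor+1,|I|)$. (i) For the stepdown procedure with constants $$\alpha_i=\frac{(\lfloor\gamma i\rfloor+1)\alpha}{s+\lfloor\gamma i\rfloor+1-i},\qquad i=1,\ldots,s,$$ one has $$P\{FDP>\gamma\}\le P\left\{\bigcup_{i=1}^{M}\left\{\hat q_{(i)}\le\frac{i\alpha}{|I|}\right\}\right\}.$$ (ii) Therefore, if the joint distribution of the p-values of the true null hypotheses satisfies Simes inequality, that is, $$P\left\{\left\{\hat q_{(1)}\le\frac{\alpha}{|I|}\right\}\cup\left\{\hat q_{(2)}\le\frac{2\alpha}{|I|}\right\}\cup\cdots\cup\{\hat q_{(|I|)}\le\alpha\}\right\}\le\alpha ,$$ then $P\{FDP>\gamma\}\le\alpha$ for this procedure.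
   Context: Data $X$ is available from some model $P\in\Omega$. A hypothesis $H_i$ is identified with a subset $\omega_i\subset\Omega$ and asserts $P\in\omega_i$. $I=I(P)=\{i: P\in\omega_i\}$ is the set of indices of true null hypotheses under the true distribution $P$. The p-values $\hat p_1,\ldots,\hat p_s$ are $[0,1]$-valued statistics (functions of $X$). Let $\hat p_{(1)}\le\cdots\le\hat p_{(s)}$ be the ordered p-values and $H_{(1)},\ldots,H_{(s)}$ the associated hypotheses (ties ordered arbitrarily). Given constants $\alpha_1\le\alpha_2\le\cdots\le\alpha_s$, the stepdown procedure with these constants is: if $\hat p_{(1)}>\alpha_1$, reject no hypotheses; otherwise reject $H_{(1)},\ldots,H_{(r)}$, where $r$ is the largest index such that $\hat p_{(1)}\le\alpha_1,\ldots,\hat p_{(r)}\le\alpha_r$. The false discovery proportion $FDP$ is the number of false rejections (rejected $H_i$ with $i\in I(P)$) divided by the total number of rejections, and is defined to be $0$ if there are no rejections. $\lfloor x\rfloor$ is the greatest integer $\le x$. *)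

theory Defs
  imports "HOL-Probability.Probability"
begin

definition true_nulls :: "nat \<Rightarrow> (nat \<Rightarrow> 'a measure set) \<Rightarrow> 'a measure \<Rightarrow> nat set" where
  "true_nulls s \<omega> P = {i \<in> {1..s}. P \<in> \<omega> i}"

text \<open>The \<open>k\<close>-th smallest of the values \<open>(p i)\<^sub>i\<^sub>\<in>\<^sub>A\<close>, counted with multiplicity; meaningful for
  finite \<open>A\<close> and \<open>1 \<le> k \<le> card A\<close>.\<close>
definition order_stat :: "nat set \<Rightarrow> (nat \<Rightarrow> real) \<Rightarrow> nat \<Rightarrow> real" where
  "order_stat A p k = sorted_list_of_multiset (image_mset p (mset_set A)) ! (k - 1)"

text \<open>\<open>\<tau> k\<close> is the index of the hypothesis \<open>H\<^sub>(\<^sub>k\<^sub>)\<close>. If some p-values coincide, several \<open>\<tau>\<close>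
  qualify, one for each way of breaking the ties.\<close>
definition orders_hypotheses :: "nat \<Rightarrow> (nat \<Rightarrow> real) \<Rightarrow> (nat \<Rightarrow> nat) \<Rightarrow> bool" where
  "orders_hypotheses s p \<tau> \<longleftrightarrow>
     bij_betw \<tau> {1..s} {1..s} \<and> (\<forall>k\<in>{1..s}. p (\<tau> k) = order_stat {1..s} p k)"

text \<open>The value is \<open>0\<close> exactly if no hypothesis is rejected, i.e. if \<open>s = 0\<close> or the smallest
  p-value exceeds \<open>a 1\<close>.\<close>
definition stepdown_count :: "nat \<Rightarrow> (nat \<Rightarrow> real) \<Rightarrow> (nat \<Rightarrow> real) \<Rightarrow> nat" where
  "stepdown_count s a p = Max {r \<in> {0..s}. \<forall>k\<in>{1..r}. order_stat {1..s} p k \<le> a k}"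

definition stepdown_rejected ::
    "nat \<Rightarrow> (nat \<Rightarrow> real) \<Rightarrow> (nat \<Rightarrow> real) \<Rightarrow> (nat \<Rightarrow> nat) \<Rightarrow> nat set" where
  "stepdown_rejected s a p \<tau> = \<tau> ` {1..stepdown_count s a p}"

definition FDP :: "nat set \<Rightarrow> nat set \<Rightarrow> real" where
  "FDP R I = (if R = {} then 0 else real (card (R \<inter> I)) / real (card R))"

definition stepdown_const :: "real \<Rightarrow> real \<Rightarrow> nat \<Rightarrow> nat \<Rightarrow> real" where
  "stepdown_const \<gamma> \<alpha> s i =
     (real_of_int \<lfloor>\<gamma> * real i\<rfloor> + 1) * \<alpha> /
     (real s + real_of_int \<lfloor>\<gamma> * real i\<rfloor> + 1 - real i)"

end

theory Submission
  imports Defs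
begin

text \<open>The inequality between probabilities comes from an inclusion of events. Fix an outcome and
  go through the hypotheses in the order of their p-values. If \<open>FDP > \<gamma>\<close>, then among the
  rejected hypotheses the true nulls make up more than the fraction \<open>\<gamma>\<close>, so there is a first
  \<open>j\<close> at which more than \<open>\<gamma> j\<close> of the leading \<open>j\<close> hypotheses are true nulls. As the count of
  true nulls grows by at most one per step, it equals \<open>m = \<lfloor>\<gamma> j\<rfloor> + 1\<close> exactly at this \<open>j\<close>
  (\<open>first_crossing_exact\<close>). This has two consequences.

  \<^item> The \<open>m\<close> true nulls found so far have p-values at most \<open>p\<^sub>(\<^sub>j\<^sub>)\<close>, hence
    \<open>q\<^sub>(\<^sub>m\<^sub>) \<le> p\<^sub>(\<^sub>j\<^sub>) \<le> \<alpha>\<^sub>j = m \<alpha> / (s + m - j)\<close>.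
  \<^item> The other \<open>j - m\<close> of the leading \<open>j\<close> hypotheses are false, hence \<open>j - m \<le> s - |I|\<close>, that is,
    \<open>|I| \<le> s + m - j\<close>.

  Together they give \<open>q\<^sub>(\<^sub>m\<^sub>) \<le> m \<alpha> / |I|\<close> with \<open>m \<le> min (\<lfloor>\<gamma> s\<rfloor> + 1) |I|\<close>
  (\<open>FDP_exceeds_imp_order_stat_le\<close>); the stepdown constants are chosen to make these two bounds
  fit. Part (ii) follows because the event in the Simes inequality contains the one in part (i).\<close>

section \<open>Order statistics through counting\<close>

lemma sorted_nth_le_iff:
  fixes xs :: "'b::linorder list"
  assumes "sorted xs" "1 \<le> k" "k \<le> length xs"
  shows "xs ! (k - 1) \<le> c \<longleftrightarrow> k \<le> length (filter (\<lambda>x. x \<le> c) xs)"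
proof -
  let ?S = "{i. i < length xs \<and> xs ! i \<le> c}"
  have len: "length (filter (\<lambda>x. x \<le> c) xs) = card ?S"
    by (rule length_filter_conv_card)
  show ?thesis
  proof (cases "xs ! (k - 1) \<le> c")
    case True
    have "{..<k} \<subseteq> ?S"
    proof
      fix i assume "i \<in> {..<k}"
      then have "i \<le> k - 1" "k - 1 < length xs" using assms by auto
      moreover from this have "xs ! i \<le> xs ! (k - 1)"
        using assms(1) by (intro sorted_nth_mono)
      ultimately show "i \<in> ?S" using True by auto
    qed
    from card_mono[OF _ this] show ?thesis using True len by simp
  next
    case False
    have "?S \<subseteq> {..<k - 1}"
    proof
      fix i assume i: "i \<in> ?S"
      show "i \<in> {..<k - 1}"
      proof (rule ccontr)
        assume "i \<notin> {..<k - 1}"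
        then have "xs ! (k - 1) \<le> xs ! i"
          using i assms(1) by (intro sorted_nth_mono) auto
        then show False using i False by auto
      qed
    qed
    from card_mono[OF _ this] show ?thesis using False len assms(2) by simp
  qed
qed

text \<open>Comparing an order statistic with a threshold amounts to counting the values below the
  threshold. All later facts on order statistics, including measurability, go through this
  equivalence.\<close>

lemma order_stat_le_iff:
  assumes "finite A" "1 \<le> k" "k \<le> card A"
  shows "order_stat A p k \<le> c \<longleftrightarrow> k \<le> card {i \<in> A. p i \<le> c}"
proof -
  define xs where "xs = sorted_list_of_multiset (image_mset p (mset_set A))"
  have mset: "mset xs = image_mset p (mset_set A)" by (simp add: xs_def)
  have "length xs = card A"
    using arg_cong[OF mset, of size] by simp
  moreover have "sorted xs" by (simp add: xs_def)
  moreover have "length (filter (\<lambda>x. x \<le> c) xs) = card {i \<in> A. p i \<le> c}"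
  proof -
    have "length (filter (\<lambda>x. x \<le> c) xs) = size (filter_mset (\<lambda>x. x \<le> c) (mset xs))"
      by (metis mset_filter size_mset)
    also have "\<dots> = card {i \<in> A. p i \<le> c}"
      using assms(1) by (simp add: mset filter_mset_image_mset filter_mset_mset_set)
    finally show ?thesis .
  qed
  ultimately show ?thesis
    using sorted_nth_le_iff[of xs k c] assms by (simp add: order_stat_def xs_def)
qed

lemma order_stat_mono:
  assumes "finite A" "1 \<le> k" "k \<le> l" "l \<le> card A"
  shows "order_stat A p k \<le> order_stat A p l"
proof -
  have "l \<le> card {i \<in> A. p i \<le> order_stat A p l}"
    using order_stat_le_iff[of A l p "order_stat A p l"] assms by simp
  then show ?thesis using assms by (subst order_stat_le_iff) auto
qed

lemma order_stat_le_measurable: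
  assumes "finite A" "1 \<le> k" "k \<le> card A"
    and p: "\<And>i. i \<in> A \<Longrightarrow> p i \<in> borel_measurable N"
  shows "{x \<in> space N. order_stat A (\<lambda>i. p i x) k \<le> c} \<in> sets N"
proof -
  \<comment> \<open>At least \<open>k\<close> values are \<open>\<le> c\<close> iff all values on some \<open>k\<close>-element subset are, which is a
    finite combination of basic events.\<close>
  let ?F = "{B \<in> Pow A. card B = k}"
  have eq: "order_stat A (\<lambda>i. p i x) k \<le> c \<longleftrightarrow> (\<exists>B\<in>?F. \<forall>i\<in>B. p i x \<le> c)" for x
  proof -
    let ?L = "{i \<in> A. p i x \<le> c}"
    have "k \<le> card ?L \<longleftrightarrow> (\<exists>B\<in>?F. \<forall>i\<in>B. p i x \<le> c)"
    proof
      assume "k \<le> card ?L"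
      then obtain B where "B \<subseteq> ?L" "card B = k"
        by (rule obtain_subset_with_card_n)
      then show "\<exists>B\<in>?F. \<forall>i\<in>B. p i x \<le> c" by blast
    next
      assume "\<exists>B\<in>?F. \<forall>i\<in>B. p i x \<le> c"
      then obtain B where "B \<subseteq> ?L" "card B = k" by blast
      then show "k \<le> card ?L" using assms(1) card_mono[of ?L B] by auto
    qed
    then show ?thesis using order_stat_le_iff[OF assms(1-3)] by simp
  qed
  have "{x \<in> space N. \<exists>B\<in>?F. \<forall>i\<in>B. p i x \<le> c} \<in> sets N"
  proof (rule sets.sets_Collect_finite_Ex)
    show "finite ?F" using assms(1) by simp
  next
    fix B assume B: "B \<in> ?F"
    then have "finite B" using assms(1) finite_subset by auto
    then show "{x \<in> space N. \<forall>i\<in>B. p i x \<le> c} \<in> sets N"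
    proof (rule sets.sets_Collect_finite_All[rotated])
      fix i assume "i \<in> B"
      then have [measurable]: "p i \<in> borel_measurable N" using B p by auto
      show "{x \<in> space N. p i x \<le> c} \<in> sets N" by measurable
    qed
  qed
  then show ?thesis by (simp add: eq)
qed

section \<open>The first index with too many true nulls\<close>

text \<open>A counter that starts at \<open>0\<close> and grows in unit steps cannot jump over the line \<open>\<gamma> j\<close>: just
  before the first index above the line it is at most \<open>\<lfloor>\<gamma> (j - 1)\<rfloor> \<le> \<lfloor>\<gamma> j\<rfloor>\<close>, so at that index it
  is at most \<open>\<lfloor>\<gamma> j\<rfloor> + 1\<close>, which is also the least integer above the line.\<close>

lemma first_crossing_exact:
  fixes n :: "nat \<Rightarrow> nat" and \<gamma> :: real
  assumes "0 \<le> \<gamma>" "n 0 = 0" and step: "\<And>k. n (Suc k) \<le> n k + 1"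
    and "\<gamma> * real r < real (n r)"
  shows "\<exists>j\<in>{1..r}. int (n j) = \<lfloor>\<gamma> * real j\<rfloor> + 1"
proof -
  define j where "j = (LEAST j. \<gamma> * real j < real (n j))"
  have above: "\<gamma> * real j < real (n j)"
    unfolding j_def by (rule LeastI) (rule assms(4))
  have "j \<le> r" unfolding j_def by (rule Least_le) (rule assms(4))
  have "j \<noteq> 0"
  proof
    assume "j = 0"
    with above assms(2) show False by simp
  qed
  then obtain k where k: "j = Suc k" using not0_implies_Suc by blast
  have "k < j" using k by simp
  then have "\<not> \<gamma> * real k < real (n k)"
    unfolding j_def by (rule not_less_Least)
  moreover have "real (n j) \<le> real (n k) + 1" using step[of k] k by simp
  moreover have "\<gamma> * real k \<le> \<gamma> * real j" using assms(1) k by (simp add: mult_left_mono)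
  ultimately have "real (n j) - 1 \<le> \<gamma> * real j" by linarith
  with above have "\<lfloor>\<gamma> * real j\<rfloor> = int (n j) - 1" by (intro floor_unique) auto
  then show ?thesis using \<open>j \<le> r\<close> \<open>j \<noteq> 0\<close> by (intro bexI[of _ j]) auto
qed

section \<open>The stepdown procedure for fixed p-values\<close>

lemma stepdown_count_le: "stepdown_count s a p \<le> s"
  and order_stat_le_below_stepdown_count:
    "k \<in> {1..stepdown_count s a p} \<Longrightarrow> order_stat {1..s} p k \<le> a k"
proof -
  let ?S = "{r \<in> {0..s}. \<forall>k\<in>{1..r}. order_stat {1..s} p k \<le> a k}"
  have "stepdown_count s a p \<in> ?S"
    unfolding stepdown_count_def by (rule Max_in) auto
  then show "stepdown_count s a p \<le> s"
    and "k \<in> {1..stepdown_count s a p} \<Longrightarrow> order_stat {1..s} p k \<le> a k" by auto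
qed

lemma FDP_exceeds_imp_order_stat_le:
  assumes ord: "orders_hypotheses s p \<tau>" and I: "I \<subseteq> {1..s}"
    and "0 < \<gamma>" "0 \<le> \<alpha>"
    and FDP: "\<gamma> < FDP (stepdown_rejected s (stepdown_const \<gamma> \<alpha> s) p \<tau>) I"
  shows "\<exists>m\<in>{1..min (nat \<lfloor>\<gamma> * real s\<rfloor> + 1) (card I)}.
           order_stat I p m \<le> real m * \<alpha> / real (card I)"
proof -
  define r where "r = stepdown_count s (stepdown_const \<gamma> \<alpha> s) p"
  define T where "T j = \<tau> ` {1..j}" for j
  define n where "n j = card (T j \<inter> I)" for j
  have finI: "finite I" using I finite_subset by blast
  have inj: "inj_on \<tau> {1..s}" and img: "\<tau> ` {1..s} = {1..s}"
    using ord by (auto simp: orders_hypotheses_def bij_betw_def)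
  have rs: "r \<le> s" unfolding r_def by (rule stepdown_count_le)
  have cardT: "card (T j) = j" if "j \<le> s" for j
    using that inj card_image[of \<tau> "{1..j}"] inj_on_subset[of \<tau> "{1..s}" "{1..j}"]
    by (auto simp: T_def)
  have T_sub: "T j \<subseteq> {1..s}" if "j \<le> s" for j
    using that img by (fastforce simp: T_def)
  have rejected: "stepdown_rejected s (stepdown_const \<gamma> \<alpha> s) p \<tau> = T r"
    by (simp add: stepdown_rejected_def T_def r_def)
  have "T r \<noteq> {}" and ratio: "\<gamma> < real (n r) / real r"
    using FDP \<open>0 < \<gamma>\<close> cardT[OF rs] by (auto simp: rejected FDP_def n_def split: if_splits)
  then have "0 < r" by (auto simp: T_def)
  with ratio have "\<gamma> * real r < real (n r)" by (simp add: field_simps)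
  moreover have "n (Suc k) \<le> n k + 1" for k
  proof -
    have "n (Suc k) \<le> card (insert (\<tau> (Suc k)) (T k \<inter> I))"
      unfolding n_def by (rule card_mono) (auto simp: T_def atLeastAtMostSuc_conv)
    also have "\<dots> \<le> n k + 1" unfolding n_def by (simp add: card_insert_if T_def)
    finally show ?thesis .
  qed
  ultimately obtain j where j: "j \<in> {1..r}" and nj: "int (n j) = \<lfloor>\<gamma> * real j\<rfloor> + 1"
    using first_crossing_exact[of \<gamma> n r] \<open>0 < \<gamma>\<close> by (auto simp: n_def T_def)
  have js: "1 \<le> j" "j \<le> s" using j rs by auto
  let ?m = "n j"
  have "0 \<le> \<gamma> * real j" using \<open>0 < \<gamma>\<close> by simp
  then have "0 \<le> \<lfloor>\<gamma> * real j\<rfloor>" by simp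
  then have m1: "1 \<le> ?m" using nj by linarith
  have mI: "?m \<le> card I" unfolding n_def using finI by (intro card_mono) auto
  have "\<gamma> * real j \<le> \<gamma> * real s" using \<open>0 < \<gamma>\<close> js by (simp add: mult_left_mono)
  then have "\<lfloor>\<gamma> * real j\<rfloor> \<le> \<lfloor>\<gamma> * real s\<rfloor>" by (rule floor_mono)
  then have ms: "?m \<le> nat \<lfloor>\<gamma> * real s\<rfloor> + 1" using nj by linarith
  \<comment> \<open>The leading \<open>j\<close> hypotheses and the true nulls share exactly \<open>m\<close> indices and lie in
    \<open>{1..s}\<close>; this is where equality in the crossing is used.\<close>
  have "card I + j \<le> s + ?m"
  proof -
    have "card (T j \<union> I) \<le> s"
      using card_mono[of "{1..s}" "T j \<union> I"] T_sub[OF js(2)] I by auto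
    moreover have "card (T j) + card I = card (T j \<union> I) + card (T j \<inter> I)"
      using finI by (intro card_Un_Int) (auto simp: T_def)
    ultimately show ?thesis using cardT[OF js(2)] by (simp add: n_def)
  qed
  then have denom: "real (card I) \<le> real s + real ?m - real j" by linarith
  have "T j \<inter> I \<subseteq> {i \<in> I. p i \<le> order_stat {1..s} p j}"
  proof
    fix i assume i: "i \<in> T j \<inter> I"
    then obtain k where k: "k \<in> {1..j}" "i = \<tau> k" by (auto simp: T_def)
    then have "p i = order_stat {1..s} p k"
      using ord js by (auto simp: orders_hypotheses_def)
    also have "\<dots> \<le> order_stat {1..s} p j"
      using k js by (intro order_stat_mono) auto
    finally show "i \<in> {i \<in> I. p i \<le> order_stat {1..s} p j}" using i by auto
  qed
  then have "?m \<le> card {i \<in> I. p i \<le> order_stat {1..s} p j}"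
    unfolding n_def using finI by (intro card_mono) auto
  then have "order_stat I p ?m \<le> order_stat {1..s} p j"
    using order_stat_le_iff[OF finI m1 mI] by simp
  also have "\<dots> \<le> stepdown_const \<gamma> \<alpha> s j"
    using j unfolding r_def by (rule order_stat_le_below_stepdown_count)
  also have "\<dots> = real ?m * \<alpha> / (real s + real ?m - real j)"
  proof -
    have "real ?m = real_of_int \<lfloor>\<gamma> * real j\<rfloor> + 1" using nj by linarith
    then show ?thesis by (simp add: stepdown_const_def algebra_simps)
  qed
  also have "\<dots> \<le> real ?m * \<alpha> / real (card I)"
    using denom m1 mI \<open>0 \<le> \<alpha>\<close> by (intro divide_left_mono) auto
  finally show ?thesis using m1 mI ms by (intro bexI[of _ ?m]) auto
qed

section \<open>Control of the false discovery proportion\<close>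

theorem theorem3p2:
  fixes N :: "'a measure"
    and \<Omega> :: "'a measure set"
    and \<omega> :: "nat \<Rightarrow> 'a measure set"
    and P :: "'a measure"
    and s :: nat
    and p :: "nat \<Rightarrow> 'a \<Rightarrow> real"
    and \<tau> :: "'a \<Rightarrow> nat \<Rightarrow> nat"
    and \<gamma> \<alpha> :: real
  assumes model: "\<Omega> \<subseteq> space (prob_algebra N)" "P \<in> \<Omega>"
    and hypotheses: "\<And>i. i \<in> {1..s} \<Longrightarrow> \<omega> i \<subseteq> \<Omega>"
    and p_values: "\<And>i. i \<in> {1..s} \<Longrightarrow> p i \<in> borel_measurable N"
      "\<And>i x. i \<in> {1..s} \<Longrightarrow> x \<in> space N \<Longrightarrow> p i x \<in> {0..1}"
    and ordering: "\<And>x. x \<in> space N \<Longrightarrow> orders_hypotheses s (\<lambda>i. p i x) (\<tau> x)"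
    and gamma: "\<gamma> \<in> {0<..<1}"
    and alpha: "\<alpha> \<in> {0<..<1}"
  shows
    "(let I = true_nulls s \<omega> P;
          q = (\<lambda>k x. order_stat I (\<lambda>i. p i x) k);
          M = min (nat \<lfloor>\<gamma> * real s\<rfloor> + 1) (card I);
          R = (\<lambda>x. stepdown_rejected s (stepdown_const \<gamma> \<alpha> s) (\<lambda>i. p i x) (\<tau> x))
      in measure P {x \<in> space P. FDP (R x) I > \<gamma>}
           \<le> measure P (\<Union>i\<in>{1..M}. {x \<in> space P. q i x \<le> real i * \<alpha> / real (card I)})
       \<and> (measure P (\<Union>i\<in>{1..card I}. {x \<in> space P. q i x \<le> real i * \<alpha> / real (card I)}) \<le> \<alpha>
           \<longrightarrow> measure P {x \<in> space P. FDP (R x) I > \<gamma>} \<le> \<alpha>))"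
proof -
  define I where "I = true_nulls s \<omega> P"
  define E where "E k = {x \<in> space P.
      order_stat I (\<lambda>i. p i x) k \<le> real k * \<alpha> / real (card I)}" for k
  define M where "M = min (nat \<lfloor>\<gamma> * real s\<rfloor> + 1) (card I)"
  define B where "B = {x \<in> space P.
      \<gamma> < FDP (stepdown_rejected s (stepdown_const \<gamma> \<alpha> s) (\<lambda>i. p i x) (\<tau> x)) I}"
  have "P \<in> space (prob_algebra N)" using model by auto
  then have prob: "prob_space P" and sets_eq: "sets P = sets N"
    by (auto simp: space_prob_algebra)
  interpret prob_space P by (rule prob)
  have space_eq: "space P = space N" using sets_eq by (rule sets_eq_imp_space_eq)
  have I: "I \<subseteq> {1..s}" by (auto simp: I_def true_nulls_def)
  then have finI: "finite I" using finite_subset by blast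
  have E: "E k \<in> sets P" if "k \<in> {1..card I}" for k
  proof -
    have "p i \<in> borel_measurable N" if "i \<in> I" for i
      using that I p_values(1) by blast
    then show ?thesis
      unfolding E_def sets_eq space_eq using finI that
      by (intro order_stat_le_measurable) auto
  qed
  \<comment> \<open>The event \<open>FDP > \<gamma>\<close> may fail to be measurable, since \<open>\<tau>\<close> breaks ties arbitrarily;
    monotonicity of \<open>measure\<close> needs measurability of the larger event only.\<close>
  have "B \<subseteq> (\<Union>k\<in>{1..M}. E k)"
  proof
    fix x assume x: "x \<in> B"
    then have "orders_hypotheses s (\<lambda>i. p i x) (\<tau> x)"
      using ordering by (simp add: B_def space_eq)
    then have "\<exists>m\<in>{1..M}. order_stat I (\<lambda>i. p i x) m \<le> real m * \<alpha> / real (card I)"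
      unfolding M_def using x I gamma alpha
      by (intro FDP_exceeds_imp_order_stat_le) (auto simp: B_def)
    then show "x \<in> (\<Union>k\<in>{1..M}. E k)" using x by (auto simp: B_def E_def)
  qed
  moreover have ME: "(\<Union>k\<in>{1..M}. E k) \<in> sets P"
    using E by (intro sets.finite_UN) (auto simp: M_def)
  ultimately have i: "measure P B \<le> measure P (\<Union>k\<in>{1..M}. E k)"
    by (rule finite_measure_mono)
  have "measure P (\<Union>k\<in>{1..M}. E k) \<le> measure P (\<Union>k\<in>{1..card I}. E k)"
    using E by (intro finite_measure_mono sets.finite_UN) (auto simp: M_def)
  with i have "measure P B \<le> \<alpha>" if "measure P (\<Union>k\<in>{1..card I}. E k) \<le> \<alpha>"
    using that by linarith
  with i show ?thesis unfolding Let_def I_def B_def E_def M_def by blast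
qed

end
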